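(* For any $\alpha>0$ and $\tau>0$ there exist constants $c_{\mathcal H}>0$ and $C>0$ depending only on $\alpha$ and $\tau$ such that for every $d\ge1$, every $\eta\in\mathbb{R}^d$ with $|\eta_1|\ge\cdots\ge|\eta_d|>0$, every $\sigma>0$ and every integer $1\le s\le d$, with $j_3(s)=\min\{\lceil s^2\log^{2/\alpha}(ed/s)\rceil,\,d\}$, the estimator $$\hat L_{\mathcal H}=\sum_{j\le j_3(s)}\eta_jy_j+\sum_{j>j_3(s)}\eta_jy_j\,\mathbf 1\Big\{|y_j|>c_{\mathcal H}\,\sigma\log^{1/\alpha}\Big(\frac{ed}{s}\Big)\Big\}$$ satisfies $$\sup_{\theta\in\Theta_s}\ \sup_{\mathcal P_\xi\in\mathcal H_{\alpha,\tau}^{\otimes}}\mathbb{E}_{\theta,\mathcal P_\xi}\big(\hat L_{\mathcal H}-L(\theta)\big)^2\ \le\ C\sigma^2\sum_{j\le j_3(s)}\eta_j^2 .$$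
   Context: Model: $\eta\in\mathbb{R}^d$ is known with $|\eta_1|\ge\cdots\ge|\eta_d|>0$; one observes $y_j=\theta_j+\sigma\xi_j$, $j=1,\dots,d$, with $\theta\in\mathbb{R}^d$ unknown, $\sigma>0$ known, and $\xi_1,\dots,\xi_d$ independent with joint law $\mathcal P_\xi$; $\mathbb{E}_{\theta,\mathcal P_\xi}$ is the corresponding expectation. $L(\theta)=\sum_{j=1}^d\eta_j\theta_j$, $\Theta_s=\{\theta\in\mathbb{R}^d:\#\{j:\theta_j\ne0\}\le s\}$. Noise class: for $\alpha,\tau>0$, $\mathcal H_{\alpha,\tau}$ is the class of distributions on $\mathbb{R}$ of random variables $W$ with $\mathbb{E}(W)=0$, $\mathbb{E}(W^2)=1$ and $\mathbb{P}(|W|\ge t)\le2\exp\{-(t/\tau)^\alpha\}$ for all $t\ge0$; $\mathcal H_{\alpha,\tau}^{\otimes}=\{\otimes_{j=1}^dP_j:P_j\in\mathcal H_{\alpha,\tau}\}$. Notation: $\log^{a}(x)=(\log x)^a$. *)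

theory Defs
  imports "HOL-Probability.Probability"
begin

text \<open>
  Vectors in \<open>\<real>\<^sup>d\<close> are functions \<^typ>\<open>nat \<Rightarrow> real\<close> of which only the coordinates
  in \<open>{1..d}\<close> are used.
\<close>

definition ordered_weights :: "nat \<Rightarrow> (nat \<Rightarrow> real) \<Rightarrow> bool" where
  "ordered_weights d \<eta> \<longleftrightarrow>
     (\<forall>i\<in>{1..d}. \<forall>j\<in>{1..d}. i \<le> j \<longrightarrow> \<bar>\<eta> j\<bar> \<le> \<bar>\<eta> i\<bar>) \<and> \<bar>\<eta> d\<bar> > 0"

definition linear_functional :: "nat \<Rightarrow> (nat \<Rightarrow> real) \<Rightarrow> (nat \<Rightarrow> real) \<Rightarrow> real" where
  "linear_functional d \<eta> \<theta> = (\<Sum>j\<in>{1..d}. \<eta> j * \<theta> j)"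

definition sparse_vectors :: "nat \<Rightarrow> nat \<Rightarrow> (nat \<Rightarrow> real) set" where
  "sparse_vectors d s = {\<theta>. card {j\<in>{1..d}. \<theta> j \<noteq> 0} \<le> s}"

definition noise_class :: "real \<Rightarrow> real \<Rightarrow> real measure set" where
  "noise_class \<alpha> \<tau> = {P. real_distribution P \<and>
     has_bochner_integral P (\<lambda>x. x) 0 \<and>
     has_bochner_integral P (\<lambda>x. x\<^sup>2) 1 \<and>
     (\<forall>t\<ge>0. measure P {x. \<bar>x\<bar> \<ge> t} \<le> 2 * exp (- ((t / \<tau>) powr \<alpha>)))}"

definition product_noise_class :: "nat \<Rightarrow> real \<Rightarrow> real \<Rightarrow> (nat \<Rightarrow> real) measure set" where
  "product_noise_class d \<alpha> \<tau> =
     {Pi\<^sub>M {1..d} P | P. \<forall>j\<in>{1..d}. P j \<in> noise_class \<alpha> \<tau>}"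

definition observation :: "real \<Rightarrow> (nat \<Rightarrow> real) \<Rightarrow> (nat \<Rightarrow> real) \<Rightarrow> nat \<Rightarrow> real" where
  "observation \<sigma> \<theta> \<xi> = (\<lambda>j. \<theta> j + \<sigma> * \<xi> j)"

text \<open>
  The expected squared error of an estimator \<open>T\<close> of the number \<open>l\<close>. As an expectation of a
  nonnegative quantity it is taken in \<open>[0, \<infinity>]\<close>, so that a finite upper bound on it includes
  integrability.
\<close>

definition mean_squared_error ::
  "real \<Rightarrow> (nat \<Rightarrow> real) \<Rightarrow> (nat \<Rightarrow> real) measure \<Rightarrow> ((nat \<Rightarrow> real) \<Rightarrow> real) \<Rightarrow> real \<Rightarrow> ennreal" where
  "mean_squared_error \<sigma> \<theta> P\<xi> T l =
     (\<integral>\<^sup>+ \<xi>. ennreal ((T (observation \<sigma> \<theta> \<xi>) - l)\<^sup>2) \<partial>P\<xi>)"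

definition j3 :: "real \<Rightarrow> nat \<Rightarrow> nat \<Rightarrow> nat" where
  "j3 \<alpha> d s =
     min (nat \<lceil>(real s)\<^sup>2 * ln (exp 1 * real d / real s) powr (2 / \<alpha>)\<rceil>) d"

definition L_hat ::
  "real \<Rightarrow> real \<Rightarrow> nat \<Rightarrow> (nat \<Rightarrow> real) \<Rightarrow> real \<Rightarrow> nat \<Rightarrow> (nat \<Rightarrow> real) \<Rightarrow> real" where
  "L_hat c \<alpha> d \<eta> \<sigma> s y =
     (\<Sum>j\<in>{1..j3 \<alpha> d s}. \<eta> j * y j) +
     (\<Sum>j\<in>{j3 \<alpha> d s<..d}. \<eta> j * y j *
        of_bool (\<bar>y j\<bar> > c * \<sigma> * ln (exp 1 * real d / real s) powr (1 / \<alpha>)))"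

end

theory Submission
  imports Defs "HOL-Real_Asymp.Real_Asymp"
begin

text \<open>
  Let \<open>m = j3(s)\<close>, \<open>l = ln (ed/s)\<close>, let \<open>u = c l\<^bsup>1/\<alpha>\<^esup>\<close> be the normalised threshold and \<open>S\<close> the
  part of the support of \<open>\<theta>\<close> beyond \<open>m\<close>. The error splits into the linear noise over \<open>{1..m} \<union> S\<close>,
  the signal lost by thresholding on \<open>S\<close>, and the noise exceeding the threshold off the support.
  The choice of \<open>m\<close> gives \<open>s\<^sup>2 l\<^bsup>2/\<alpha>\<^esup> \<eta>\<^sub>j\<^sup>2 \<le> V = \<Sum>\<^sub>i\<^sub>\<le>\<^sub>m \<eta>\<^sub>i\<^sup>2\<close> for \<open>j > m\<close>. Since \<open>S\<close> has at
  most \<open>s\<close> elements, this bounds the first part by \<open>2 \<sigma>\<^sup>2 V\<close> in mean square and the second one by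
  \<open>c\<^sup>2 \<sigma>\<^sup>2 V\<close>. The summands of the third part need not be centred, so it is estimated by the
  Cauchy-Schwarz inequality alone, at the price of a factor \<open>d\<^sup>2\<close>; the value of \<open>c\<close> is chosen
  so that the truncated second moments are \<open>O((s/d)\<^sup>2)\<close>, which makes up for that factor.
\<close>

section \<open>Truncated second moments under a stretched exponential tail\<close>

lemma summable_stretched_exp:
  fixes \<alpha> \<tau> :: real
  assumes "\<alpha> > 0" "\<tau> > 0"
  shows "summable (\<lambda>k. (real k + 1)\<^sup>2 * exp (- ((real k / \<tau>) powr \<alpha>) / 2))"
proof (rule summable_comparison_test_bigo)
  show "summable (\<lambda>k. norm (1 / (real k)\<^sup>2))"
    using inverse_power_summable[of 2, where 'a=real] by (simp add: divide_inverse)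
  show "(\<lambda>k. (real k + 1)\<^sup>2 * exp (- ((real k / \<tau>) powr \<alpha>) / 2)) \<in> O(\<lambda>k. 1 / (real k)\<^sup>2)"
    using assms by real_asymp
qed

text \<open>With k the integer part of |x|, the integrand is at most (k+1)^2 times the indicator of
  |x| \<ge> max k u. Half of the tail exponent there makes the series over k converge, the other
  half supplies the decay in \<open>u\<close>; hence the factor 1/2 in both exponents.\<close>

lemma truncated_second_moment_le:
  fixes P :: "real measure"
  assumes P: "prob_space P" and [measurable_cong]: "sets P = sets borel"
    and tail: "\<And>t. t \<ge> 0 \<Longrightarrow> measure P {x. \<bar>x\<bar> \<ge> t} \<le> 2 * exp (- ((t / \<tau>) powr \<alpha>))"
    and "\<alpha> > 0" "\<tau> > 0" "u \<ge> 0"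
  shows "(\<integral>\<^sup>+x. ennreal (x\<^sup>2 * of_bool (\<bar>x\<bar> > u)) \<partial>P) \<le>
    ennreal (2 * (\<Sum>k. (real k + 1)\<^sup>2 * exp (- ((real k / \<tau>) powr \<alpha>) / 2)) * exp (- ((u / \<tau>) powr \<alpha>) / 2))"
proof -
  interpret P: prob_space P by fact
  define g where "g k = (real k + 1)\<^sup>2 * exp (- ((real k / \<tau>) powr \<alpha>) / 2)" for k
  have g: "summable g" "\<And>k. g k \<ge> 0"
    unfolding g_def[abs_def] using summable_stretched_exp assms by auto
  define E where "E = exp (- ((u / \<tau>) powr \<alpha>) / 2)"
  have le_suminf: "h k \<le> suminf h" for h :: "nat \<Rightarrow> ennreal" and k
    using sum_le_suminf[of h "{k}"] by simp
  have "(\<integral>\<^sup>+x. ennreal (x\<^sup>2 * of_bool (\<bar>x\<bar> > u)) \<partial>P) \<le>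
    (\<integral>\<^sup>+x. (\<Sum>k. ennreal ((real k + 1)\<^sup>2) * indicator {x. \<bar>x\<bar> \<ge> max (real k) u} x) \<partial>P)"
  proof (rule nn_integral_mono)
    fix x :: real
    define k where "k = nat \<lfloor>\<bar>x\<bar>\<rfloor>"
    have k: "real k \<le> \<bar>x\<bar>" "\<bar>x\<bar> \<le> real k + 1"
      unfolding k_def by linarith+
    have "x\<^sup>2 \<le> (real k + 1)\<^sup>2"
      using k power_mono[of "\<bar>x\<bar>" "real k + 1" 2] by simp
    hence "ennreal (x\<^sup>2 * of_bool (\<bar>x\<bar> > u)) \<le> ennreal ((real k + 1)\<^sup>2) * indicator {x. \<bar>x\<bar> \<ge> max (real k) u} x"
      using k by (auto simp: indicator_def intro: ennreal_leI)
    also have "\<dots> \<le> (\<Sum>k. ennreal ((real k + 1)\<^sup>2) * indicator {x. \<bar>x\<bar> \<ge> max (real k) u} x)"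
      by (rule le_suminf)
    finally show "ennreal (x\<^sup>2 * of_bool (\<bar>x\<bar> > u)) \<le>
      (\<Sum>k. ennreal ((real k + 1)\<^sup>2) * indicator {x. \<bar>x\<bar> \<ge> max (real k) u} x)" .
  qed
  also have "\<dots> = (\<Sum>k. \<integral>\<^sup>+x. ennreal ((real k + 1)\<^sup>2) * indicator {x. \<bar>x\<bar> \<ge> max (real k) u} x \<partial>P)"
    by (rule nn_integral_suminf) measurable
  also have "\<dots> \<le> (\<Sum>k. ennreal (2 * E * g k))"
  proof (rule suminf_le)
    fix k
    define t where "t = max (real k) u"
    have t: "t \<ge> 0" "t \<ge> real k" "t \<ge> u" by (auto simp: t_def)
    \<comment> \<open>\<open>t\<close> dominates both \<open>real k\<close> and \<open>u\<close>, so
      its power is at least the average of theirs.\<close>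
    have "(real k / \<tau>) powr \<alpha> \<le> (t / \<tau>) powr \<alpha>" "(u / \<tau>) powr \<alpha> \<le> (t / \<tau>) powr \<alpha>"
      using t assms by (auto intro!: powr_mono2 divide_right_mono)
    hence "- ((t / \<tau>) powr \<alpha>) \<le> - ((u / \<tau>) powr \<alpha>) / 2 + - ((real k / \<tau>) powr \<alpha>) / 2"
      by argo
    hence "exp (- ((t / \<tau>) powr \<alpha>)) \<le> E * exp (- ((real k / \<tau>) powr \<alpha>) / 2)"
      unfolding E_def exp_add[symmetric] by simp
    hence m: "measure P {x. \<bar>x\<bar> \<ge> t} \<le> 2 * (E * exp (- ((real k / \<tau>) powr \<alpha>) / 2))"
      using tail[OF t(1)] by linarith
    have "(\<integral>\<^sup>+x. ennreal ((real k + 1)\<^sup>2) * indicator {x. \<bar>x\<bar> \<ge> t} x \<partial>P)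
        = ennreal ((real k + 1)\<^sup>2) * emeasure P {x. \<bar>x\<bar> \<ge> t}"
      by (rule nn_integral_cmult_indicator) measurable
    also have "\<dots> = ennreal ((real k + 1)\<^sup>2 * measure P {x. \<bar>x\<bar> \<ge> t})"
      by (simp add: P.emeasure_eq_measure ennreal_mult)
    also have "\<dots> \<le> ennreal (2 * E * g k)"
      using mult_left_mono[OF m, of "(real k + 1)\<^sup>2"]
      by (intro ennreal_leI) (simp add: g_def algebra_simps)
    finally show "(\<integral>\<^sup>+x. ennreal ((real k + 1)\<^sup>2) * indicator {x. \<bar>x\<bar> \<ge> max (real k) u} x \<partial>P)
        \<le> ennreal (2 * E * g k)" by (simp add: t_def)
  qed auto
  also have "\<dots> = ennreal (\<Sum>k. 2 * E * g k)"
    using g by (intro suminf_ennreal2 summable_mult) (auto simp: E_def)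
  also have "(\<Sum>k. 2 * E * g k) = 2 * (\<Sum>k. g k) * E"
    using suminf_mult[OF g(1), of "2 * E"] by simp
  finally show ?thesis by (simp add: g_def E_def)
qed

section \<open>Moments under the product law\<close>

text \<open>Expanding the square leaves the mixed moments of \<open>\<xi> i * \<xi> j\<close>, which
  by independence and centring are 1 for i = j and 0 otherwise.\<close>

lemma nn_integral_square_sum_PiM:
  fixes P :: "'i \<Rightarrow> real measure" and a :: "'i \<Rightarrow> real"
  assumes I: "finite I" and A: "A \<subseteq> I"
    and P: "\<And>i. i \<in> I \<Longrightarrow> prob_space (P i)"
    and mean: "\<And>i. i \<in> I \<Longrightarrow> has_bochner_integral (P i) (\<lambda>x. x) 0"
    and var: "\<And>i. i \<in> I \<Longrightarrow> has_bochner_integral (P i) (\<lambda>x. x\<^sup>2) 1"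
  shows "(\<integral>\<^sup>+\<xi>. ennreal ((\<Sum>j\<in>A. a j * \<xi> j)\<^sup>2) \<partial>Pi\<^sub>M I P) = ennreal (\<Sum>j\<in>A. (a j)\<^sup>2)"
proof -
  \<comment> \<open>\<^locale>\<open>product_sigma_finite\<close> asks for a condition on the factors at all indices, also outside \<open>I\<close>.\<close>
  define Q where "Q i = (if i \<in> I then P i else return borel 0)" for i
  have Q: "prob_space (Q i)" for i
    using P by (auto simp: Q_def intro!: prob_space_return)
  have PQ: "Pi\<^sub>M I P = Pi\<^sub>M I Q"
    by (rule PiM_cong) (auto simp: Q_def)
  interpret product_sigma_finite Q
    unfolding product_sigma_finite_def using Q prob_space_imp_sigma_finite by blast
  interpret PQ: prob_space "Pi\<^sub>M I Q"
    using Q by (rule prob_space_PiM)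
  have cov: "has_bochner_integral (Pi\<^sub>M I Q) (\<lambda>\<xi>. \<xi> i * \<xi> j) (of_bool (i = j))"
    if ij: "i \<in> I" "j \<in> I" for i j
  proof -
    \<comment> \<open>The product of two coordinates is written as a product over all of
      \<open>I\<close> of functions of one coordinate, so that the integral factorises. The factor
      \<open>f k\<close> is x^2 for k = i = j, x if k is one of two distinct indices, and 1
      elsewhere; its integral vanishes only in the middle case.\<close>
    define f :: "'i \<Rightarrow> real \<Rightarrow> real"
      where "f k x = (if k = i then x else 1) * (if k = j then x else 1)" for k x
    have f: "has_bochner_integral (Q k) (f k) (of_bool (i = j \<or> k \<notin> {i, j}))" if "k \<in> I" for k
    proof -
      interpret k: prob_space "P k" using P that .
      show ?thesis
        using mean[OF that] var[OF that] that k.prob_space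
        by (cases "k = i"; cases "k = j")
           (auto simp: f_def[abs_def] Q_def power2_eq_square has_bochner_integral_iff)
    qed
    have "(\<Prod>k\<in>I. f k (\<xi> k)) = \<xi> i * \<xi> j" for \<xi>
      using I ij by (simp add: f_def prod.distrib prod.delta)
    moreover have "(\<Prod>k\<in>I. of_bool (i = j \<or> k \<notin> {i, j}) :: real) = of_bool (i = j)"
      using I ij by (cases "i = j") (auto simp: prod_zero_iff)
    ultimately show ?thesis
      using product_integrable_prod[OF I, of f] product_integral_prod[OF I, of f] f
      by (simp add: has_bochner_integral_iff)
  qed
  have "has_bochner_integral (Pi\<^sub>M I Q) (\<lambda>\<xi>. \<Sum>i\<in>A. \<Sum>j\<in>A. a i * a j * (\<xi> i * \<xi> j))
      (\<Sum>i\<in>A. \<Sum>j\<in>A. a i * a j * of_bool (i = j))"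
    using A by (intro has_bochner_integral_sum has_bochner_integral_mult_right cov) auto
  also have "(\<lambda>\<xi>. \<Sum>i\<in>A. \<Sum>j\<in>A. a i * a j * (\<xi> i * \<xi> j)) = (\<lambda>\<xi>. (\<Sum>j\<in>A. a j * \<xi> j)\<^sup>2)"
    by (simp add: power2_eq_square sum_product algebra_simps)
  also have "(\<Sum>i\<in>A. \<Sum>j\<in>A. a i * a j * of_bool (i = j)) = (\<Sum>j\<in>A. (a j)\<^sup>2)"
    using finite_subset[OF A I] by (simp add: power2_eq_square of_bool_def if_distrib sum.delta cong: if_cong)
  finally show ?thesis
    unfolding PQ by (subst nn_integral_eq_integral) (auto simp: has_bochner_integral_iff)
qed

lemma nn_integral_PiM_component:
  assumes P: "\<And>i. i \<in> I \<Longrightarrow> prob_space (P i)" and "i \<in> I" "f \<in> borel_measurable (P i)"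
  shows "(\<integral>\<^sup>+\<xi>. f (\<xi> i) \<partial>Pi\<^sub>M I P) = (\<integral>\<^sup>+x. f x \<partial>P i)"
proof -
  have "(\<integral>\<^sup>+x. f x \<partial>P i) = (\<integral>\<^sup>+x. f x \<partial>distr (Pi\<^sub>M I P) (P i) (\<lambda>\<xi>. \<xi> i))"
    by (subst distr_PiM_component) (use assms in auto)
  also have "\<dots> = (\<integral>\<^sup>+\<xi>. f (\<xi> i) \<partial>Pi\<^sub>M I P)"
    using assms by (intro nn_integral_distr) auto
  finally show ?thesis by simp
qed


section \<open>Deterministic decomposition of the error\<close>

text \<open>The inequality holds for each realisation of the noise. A coordinate in \<open>S\<close>
  contributes its weighted noise, minus its weighted observation if that is rejected; a rejected
  observation is at most \<sigma>u in absolute value, however large or small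
  \<open>\<theta> j\<close> is. Beyond \<open>m\<close> and off \<open>S\<close> the observation is
  \<sigma> times the noise, so the threshold acts on the noise alone.\<close>

lemma L_hat_error_le:
  fixes \<theta> \<xi> :: "nat \<Rightarrow> real" and \<alpha> c :: real and d s :: nat
  assumes "\<sigma> > 0" "c \<ge> 0"
  defines "m \<equiv> j3 \<alpha> d s"
  defines "u \<equiv> c * ln (exp 1 * real d / real s) powr (1 / \<alpha>)"
  defines "S \<equiv> {j \<in> {m<..d}. \<theta> j \<noteq> 0}"
  shows "(L_hat c \<alpha> d \<eta> \<sigma> s (observation \<sigma> \<theta> \<xi>) - linear_functional d \<eta> \<theta>)\<^sup>2 \<le>
    3 * \<sigma>\<^sup>2 * (\<Sum>j\<in>{1..m} \<union> S. \<eta> j * \<xi> j)\<^sup>2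
    + 3 * \<sigma>\<^sup>2 * (u\<^sup>2 * (\<Sum>j\<in>S. \<bar>\<eta> j\<bar>)\<^sup>2)
    + 3 * \<sigma>\<^sup>2 * (real d * (\<Sum>j\<in>{m<..d}. (\<eta> j)\<^sup>2 * ((\<xi> j)\<^sup>2 * of_bool (\<bar>\<xi> j\<bar> > u))))"
proof -
  define y where "y = observation \<sigma> \<theta> \<xi>"
  have y: "y j = \<theta> j + \<sigma> * \<xi> j" for j
    by (simp add: y_def observation_def)
  define T where "T = {m<..d} - S"
  have fin: "finite S" "finite T"
    by (auto simp: S_def T_def)
  have T0: "\<theta> j = 0" if "j \<in> T" for j
    using that by (auto simp: T_def S_def)
  have R: "{m<..d} = S \<union> T" "S \<inter> T = {}" "{1..m} \<inter> S = {}" "{1..d} = {1..m} \<union> {m<..d}" "{1..m} \<inter> {m<..d} = {}"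
    by (auto simp: S_def T_def m_def j3_def)
  define z where "z j = \<eta> j * y j * of_bool (\<bar>y j\<bar> > \<sigma> * u) - \<eta> j * \<theta> j" for j
  define p where "p = (\<Sum>j\<in>{1..m} \<union> S. \<eta> j * \<xi> j)"
  define q where "q = (\<Sum>j\<in>S. \<eta> j * (y j * of_bool (\<bar>y j\<bar> \<le> \<sigma> * u)))"
  define r where "r = (\<Sum>j\<in>T. \<eta> j * (\<xi> j * of_bool (\<bar>\<xi> j\<bar> > u)))"
  have "L_hat c \<alpha> d \<eta> \<sigma> s y - linear_functional d \<eta> \<theta> = (\<Sum>j\<in>{1..m}. \<sigma> * (\<eta> j * \<xi> j)) + (\<Sum>j\<in>{m<..d}. z j)"
  proof -
    have "linear_functional d \<eta> \<theta> = (\<Sum>j\<in>{1..m}. \<eta> j * \<theta> j) + (\<Sum>j\<in>{m<..d}. \<eta> j * \<theta> j)"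
      unfolding linear_functional_def R(4) by (rule sum.union_disjoint) (use R(5) in auto)
    moreover have "L_hat c \<alpha> d \<eta> \<sigma> s y =
      (\<Sum>j\<in>{1..m}. \<eta> j * y j) + (\<Sum>j\<in>{m<..d}. \<eta> j * y j * of_bool (\<bar>y j\<bar> > \<sigma> * u))"
      by (simp add: L_hat_def m_def u_def mult_ac)
    ultimately show ?thesis
      unfolding z_def sum_subtractf by (simp add: y algebra_simps sum.distrib)
  qed
  also have "(\<Sum>j\<in>{m<..d}. z j) = (\<Sum>j\<in>S. z j) + (\<Sum>j\<in>T. z j)"
    unfolding R(1) by (rule sum.union_disjoint) (use R fin in auto)
  also have "(\<Sum>j\<in>S. z j) = (\<Sum>j\<in>S. \<sigma> * (\<eta> j * \<xi> j)) - q"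
    unfolding q_def sum_subtractf[symmetric] by (rule sum.cong) (auto simp: z_def y algebra_simps)
  also have "(\<Sum>j\<in>T. z j) = \<sigma> * r"
    unfolding r_def sum_distrib_left
    by (rule sum.cong) (use assms(1) T0 in \<open>auto simp: z_def y abs_mult\<close>)
  also have "(\<Sum>j\<in>{1..m}. \<sigma> * (\<eta> j * \<xi> j)) + ((\<Sum>j\<in>S. \<sigma> * (\<eta> j * \<xi> j)) - q + \<sigma> * r) = \<sigma> * p - q + \<sigma> * r"
    unfolding p_def using R fin by (subst sum.union_disjoint) (auto simp: sum_distrib_left distrib_left)
  finally have err: "L_hat c \<alpha> d \<eta> \<sigma> s y - linear_functional d \<eta> \<theta> = \<sigma> * p - q + \<sigma> * r" .
  have "\<bar>q\<bar> \<le> (\<Sum>j\<in>S. \<bar>\<eta> j\<bar> * (\<sigma> * u))"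
  proof (unfold q_def, intro order.trans[OF sum_abs] sum_mono)
    fix j assume "j \<in> S"
    show "\<bar>\<eta> j * (y j * of_bool (\<bar>y j\<bar> \<le> \<sigma> * u))\<bar> \<le> \<bar>\<eta> j\<bar> * (\<sigma> * u)"
      using assms(1,2) by (auto simp: abs_mult u_def intro!: mult_left_mono)
  qed
  hence "q\<^sup>2 \<le> (\<sigma> * u * (\<Sum>j\<in>S. \<bar>\<eta> j\<bar>))\<^sup>2"
    by (subst abs_le_square_iff[symmetric]) (simp add: sum_distrib_left mult_ac)
  hence q: "q\<^sup>2 \<le> \<sigma>\<^sup>2 * (u\<^sup>2 * (\<Sum>j\<in>S. \<bar>\<eta> j\<bar>)\<^sup>2)"
    by (simp add: power_mult_distrib mult_ac)
  \<comment> \<open>Cauchy-Schwarz against the constant 1 gives the factor \<open>card T\<close>;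
    enlarging \<open>T\<close> to all indices beyond \<open>m\<close> then removes the dependence on
    \<theta>.\<close>
  have "r\<^sup>2 \<le> real (card T) * (\<Sum>j\<in>T. (\<eta> j * (\<xi> j * of_bool (\<bar>\<xi> j\<bar> > u)))\<^sup>2)"
    unfolding r_def using Cauchy_Schwarz_ineq_sum[of "\<lambda>_. 1" "\<lambda>j. \<eta> j * (\<xi> j * of_bool (\<bar>\<xi> j\<bar> > u))" T]
    by simp
  also have "\<dots> = real (card T) * (\<Sum>j\<in>T. (\<eta> j)\<^sup>2 * ((\<xi> j)\<^sup>2 * of_bool (\<bar>\<xi> j\<bar> > u)))"
    by (intro arg_cong[where f = "\<lambda>x. real (card T) * x"] sum.cong refl) (auto simp: power_mult_distrib)
  also have "\<dots> \<le> real d * (\<Sum>j\<in>{m<..d}. (\<eta> j)\<^sup>2 * ((\<xi> j)\<^sup>2 * of_bool (\<bar>\<xi> j\<bar> > u)))"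
  proof (intro mult_mono sum_mono2)
    have "card T \<le> card {m<..d}" by (rule card_mono) (auto simp: T_def)
    thus "real (card T) \<le> real d" by simp
  qed (auto simp: R(1) fin sum_nonneg)
  finally have r: "r\<^sup>2 \<le> \<dots>" .
  have "(\<sigma> * p - q + \<sigma> * r)\<^sup>2 \<le> 3 * ((\<sigma> * p)\<^sup>2 + q\<^sup>2 + (\<sigma> * r)\<^sup>2)"
  proof -
    \<comment> \<open>The gap is a sum of three squares; the plus signs next to \<open>q\<close>
      reflect its minus sign in the error.\<close>
    have "3 * ((\<sigma> * p)\<^sup>2 + q\<^sup>2 + (\<sigma> * r)\<^sup>2) - (\<sigma> * p - q + \<sigma> * r)\<^sup>2
      = (\<sigma> * p + q)\<^sup>2 + (\<sigma> * p - \<sigma> * r)\<^sup>2 + (q + \<sigma> * r)\<^sup>2"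
      by algebra
    thus ?thesis
      by (smt (verit) zero_le_power2)
  qed
  also have "\<dots> = 3 * \<sigma>\<^sup>2 * p\<^sup>2 + 3 * q\<^sup>2 + 3 * \<sigma>\<^sup>2 * r\<^sup>2"
    by (simp add: power_mult_distrib)
  finally show ?thesis
    using q mult_left_mono[OF r, of "3 * \<sigma>\<^sup>2"]
    unfolding y_def[symmetric] err p_def by simp
qed

section \<open>The cutoff index and the weights beyond it\<close>

lemma ln_exp_ratio_ge_1:
  assumes "1 \<le> s" "s \<le> (d::nat)"
  shows "ln (exp 1 * real d / real s) \<ge> 1"
proof -
  have "exp 1 * real d / real s \<ge> exp 1" using assms by (simp add: field_simps)
  moreover have "exp 1 * real d / real s > 0" using assms by simp
  ultimately show ?thesis by (simp add: ln_ge_iff)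
qed

text \<open>If \<open>j3\<close> is below \<open>d\<close>, the minimum in its definition is the
  rounded-up term, hence at least s^2 ln(ed/s)^(2/\<alpha>). Each of the first \<open>j3\<close>
  squared weights is at least the next one, so their sum is at least \<open>j3\<close> times that
  one.\<close>

lemma tail_weight_le:
  assumes "ordered_weights d \<eta>" "1 \<le> s" "s \<le> d" "j3 \<alpha> d s < d"
  shows "(real s)\<^sup>2 * ln (exp 1 * real d / real s) powr (2 / \<alpha>) * (\<eta> (Suc (j3 \<alpha> d s)))\<^sup>2
    \<le> (\<Sum>j\<in>{1..j3 \<alpha> d s}. (\<eta> j)\<^sup>2)"
proof -
  define m where "m = j3 \<alpha> d s"
  have m: "(real s)\<^sup>2 * ln (exp 1 * real d / real s) powr (2 / \<alpha>) \<le> real m"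
    using assms(4) unfolding m_def j3_def by (auto simp: min_def split: if_splits)
  have "(\<eta> (Suc m))\<^sup>2 \<le> (\<eta> j)\<^sup>2" if "j \<in> {1..m}" for j
    using assms that unfolding ordered_weights_def m_def abs_le_square_iff[symmetric] by auto
  hence "real m * (\<eta> (Suc m))\<^sup>2 \<le> (\<Sum>j\<in>{1..m}. (\<eta> j)\<^sup>2)"
    using sum_mono[of "{1..m}" "\<lambda>_. (\<eta> (Suc m))\<^sup>2" "\<lambda>j. (\<eta> j)\<^sup>2"] by simp
  with mult_right_mono[OF m, of "(\<eta> (Suc m))\<^sup>2"] show ?thesis
    by (simp add: m_def)
qed

section \<open>Risk bound for a fixed parameter and noise law\<close>

text \<open>In the constant, 3 comes from splitting the error into three parts, and 2, c^2 and
  \<open>K\<close> bound the linear noise, the lost signal and the noise that passes the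
  threshold.\<close>

lemma mean_squared_error_L_hat_le:
  fixes \<alpha> \<tau> \<sigma> :: real
  assumes "\<alpha> > 0" "\<tau> > 0" "\<sigma> > 0" "ordered_weights d \<eta>" "1 \<le> s" "s \<le> d"
    and \<theta>: "\<theta> \<in> sparse_vectors d s" and P: "\<And>j. j \<in> {1..d} \<Longrightarrow> P j \<in> noise_class \<alpha> \<tau>"
  defines "c \<equiv> \<tau> * 4 powr (1 / \<alpha>)"
    and "K \<equiv> 2 * (\<Sum>k. (real k + 1)\<^sup>2 * exp (- ((real k / \<tau>) powr \<alpha>) / 2))"
  shows "mean_squared_error \<sigma> \<theta> (Pi\<^sub>M {1..d} P) (L_hat c \<alpha> d \<eta> \<sigma> s) (linear_functional d \<eta> \<theta>)
    \<le> ennreal (3 * (2 + c\<^sup>2 + K) * \<sigma>\<^sup>2 * (\<Sum>j\<in>{1..j3 \<alpha> d s}. (\<eta> j)\<^sup>2))"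
proof -
  define m where "m = j3 \<alpha> d s"
  define l where "l = ln (exp 1 * real d / real s)"
  define u where "u = c * l powr (1 / \<alpha>)"
  define S where "S = {j \<in> {m<..d}. \<theta> j \<noteq> 0}"
  define V where "V = (\<Sum>j\<in>{1..m}. (\<eta> j)\<^sup>2)"
  have V: "V \<ge> 0" by (simp add: V_def sum_nonneg)
  have c: "c > 0" using assms by (simp add: c_def)
  have l: "l \<ge> 1" using ln_exp_ratio_ge_1 assms by (simp add: l_def)
  have u: "u \<ge> 0" using c by (simp add: u_def)
  have K: "K \<ge> 0"
    unfolding K_def using summable_stretched_exp[of \<alpha> \<tau>] assms(1,2) by (auto intro!: suminf_nonneg)
  have prob: "prob_space (P j)" and sets_P [measurable_cong]: "sets (P j) = sets borel"
    and mean: "has_bochner_integral (P j) (\<lambda>x. x) 0" and var: "has_bochner_integral (P j) (\<lambda>x. x\<^sup>2) 1"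
    and tail: "\<And>t. t \<ge> 0 \<Longrightarrow> measure (P j) {x. \<bar>x\<bar> \<ge> t} \<le> 2 * exp (- ((t / \<tau>) powr \<alpha>))"
    if "j \<in> {1..d}" for j
    using P[OF that] by (auto simp: noise_class_def real_distribution_def real_distribution_axioms_def)
  interpret PP: prob_space "Pi\<^sub>M {1..d} P"
    using prob by (rule prob_space_PiM)
  have sub: "{1..m} \<union> S \<subseteq> {1..d}"
    by (auto simp: m_def j3_def S_def)

  have "card S \<le> card {j \<in> {1..d}. \<theta> j \<noteq> 0}"
    by (rule card_mono) (auto simp: S_def)
  hence card_S: "card S \<le> s"
    using \<theta> by (simp add: sparse_vectors_def)
  \<comment> \<open>For m < d this is the largest absolute weight beyond \<open>m\<close>. For m = d
    the index \<open>Suc m\<close> lies outside 1..d, so the bounds below treat that case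
    separately: the sums beyond \<open>m\<close> are then empty.\<close>
  define \<beta> where "\<beta> = \<bar>\<eta> (Suc m)\<bar>"
  have \<beta>: "\<bar>\<eta> j\<bar> \<le> \<beta>" if "j \<in> {m<..d}" for j
    using assms(4) that unfolding ordered_weights_def \<beta>_def by auto
  have sq: "(\<eta> j)\<^sup>2 \<le> \<beta>\<^sup>2" if "j \<in> {m<..d}" for j
    using power_mono[OF \<beta>[OF that], of 2] by simp
  have weight: "(real s)\<^sup>2 * l powr (2 / \<alpha>) * \<beta>\<^sup>2 \<le> V" if "m < d"
    using tail_weight_le[of d \<eta> s \<alpha>] that assms by (simp add: m_def l_def \<beta>_def V_def)
  have weight': "(real s)\<^sup>2 * \<beta>\<^sup>2 \<le> V" if "m < d"
  proof -
    have "(real s)\<^sup>2 * \<beta>\<^sup>2 * 1 \<le> (real s)\<^sup>2 * \<beta>\<^sup>2 * l powr (2 / \<alpha>)"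
      using l assms(1) by (intro mult_left_mono ge_one_powr_ge_zero) auto
    with weight[OF that] show ?thesis by (simp add: mult_ac)
  qed

  \<comment> \<open>The three contributions to the risk\<close>
  have 1: "(\<Sum>j\<in>{1..m} \<union> S. (\<eta> j)\<^sup>2) \<le> 2 * V"
  proof -
    have "(\<Sum>j\<in>S. (\<eta> j)\<^sup>2) \<le> V"
    proof (cases "m < d")
      case True
      have "(\<Sum>j\<in>S. (\<eta> j)\<^sup>2) \<le> real (card S) * \<beta>\<^sup>2"
        using sum_bounded_above[of S "\<lambda>j. (\<eta> j)\<^sup>2" "\<beta>\<^sup>2"] sq by (auto simp: S_def)
      \<comment> \<open>Passing from s to s^2, by s \<ge> 1, is affordable because
        \<open>weight'\<close> carries s^2.\<close>
      also have "\<dots> \<le> (real s)\<^sup>2 * \<beta>\<^sup>2"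
      proof (rule mult_right_mono)
        have "real (card S) \<le> real s * 1" using card_S by simp
        also have "\<dots> \<le> real s * real s" using assms(5) by (intro mult_left_mono) auto
        finally show "real (card S) \<le> (real s)\<^sup>2" by (simp add: power2_eq_square)
      qed auto
      finally show ?thesis using weight'[OF True] by simp
    qed (use V in \<open>simp add: S_def\<close>)
    thus ?thesis
      by (subst sum.union_disjoint) (auto simp: S_def V_def)
  qed

  have 2: "u\<^sup>2 * (\<Sum>j\<in>S. \<bar>\<eta> j\<bar>)\<^sup>2 \<le> c\<^sup>2 * V"
  proof (cases "m < d")
    case True
    \<comment> \<open>Squaring the threshold produces exactly the power of \<open>l\<close> built
      into \<open>j3\<close>; for this contribution \<open>weight\<close> is used in full.\<close>
    have u2: "u\<^sup>2 = c\<^sup>2 * l powr (2 / \<alpha>)"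
      using l by (simp add: u_def power_mult_distrib powr_power mult.commute)
    have "(\<Sum>j\<in>S. \<bar>\<eta> j\<bar>) \<le> real (card S) * \<beta>"
      using sum_bounded_above[of S "\<lambda>j. \<bar>\<eta> j\<bar>" \<beta>] \<beta> by (auto simp: S_def)
    also have "\<dots> \<le> real s * \<beta>"
      using card_S by (intro mult_right_mono) (auto simp: \<beta>_def)
    finally have "(\<Sum>j\<in>S. \<bar>\<eta> j\<bar>)\<^sup>2 \<le> (real s * \<beta>)\<^sup>2"
      by (intro power_mono) (auto intro: sum_nonneg)
    hence "u\<^sup>2 * (\<Sum>j\<in>S. \<bar>\<eta> j\<bar>)\<^sup>2 \<le> u\<^sup>2 * (real s * \<beta>)\<^sup>2"
      by (intro mult_left_mono) auto
    also have "\<dots> = c\<^sup>2 * ((real s)\<^sup>2 * l powr (2 / \<alpha>) * \<beta>\<^sup>2)"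
      by (simp add: u2 power_mult_distrib)
    also have "\<dots> \<le> c\<^sup>2 * V"
      using weight[OF True] by (intro mult_left_mono) auto
    finally show ?thesis .
  qed (use V in \<open>simp add: S_def\<close>)

  \<comment> \<open>The order (s/d)^2 is chosen so that d^2 D = K s^2, which \<open>weight'\<close>
    absorbs.\<close>
  define D where "D = K * (real s / real d)\<^sup>2"
  have D: "D \<ge> 0" using K by (simp add: D_def)
  have trunc: "(\<integral>\<^sup>+\<xi>. ennreal ((\<xi> j)\<^sup>2 * of_bool (\<bar>\<xi> j\<bar> > u)) \<partial>Pi\<^sub>M {1..d} P) \<le> ennreal D"
    if j: "j \<in> {1..d}" for j
  proof -
    note [measurable_cong] = sets_P[OF j]
    \<comment> \<open>The 4 in \<open>c\<close> takes effect here: halving the exponent leaves 2l,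
      and exp(-2l) = (s/(ed))^2 has the required order. The factor e^(-2) is then discarded.\<close>
    have "(u / \<tau>) powr \<alpha> = 4 * l"
      using assms(1,2) l by (simp add: u_def c_def powr_mult powr_powr)
    hence "exp (- ((u / \<tau>) powr \<alpha>) / 2) = (exp (- l))\<^sup>2"
      by (simp add: power2_eq_square exp_add[symmetric])
    also have "exp (- l) = real s / (exp 1 * real d)"
      using assms(5,6) by (simp add: l_def exp_minus)
    also have "(real s / (exp 1 * real d))\<^sup>2 \<le> (real s / real d)\<^sup>2"
      using assms(5,6) by (intro power_mono divide_left_mono) auto
    finally have e: "K * exp (- ((u / \<tau>) powr \<alpha>) / 2) \<le> D"
      using K by (auto simp: D_def intro: mult_left_mono)
    have "(\<integral>\<^sup>+\<xi>. ennreal ((\<xi> j)\<^sup>2 * of_bool (\<bar>\<xi> j\<bar> > u)) \<partial>Pi\<^sub>M {1..d} P)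
        = (\<integral>\<^sup>+x. ennreal (x\<^sup>2 * of_bool (\<bar>x\<bar> > u)) \<partial>P j)"
      by (rule nn_integral_PiM_component[where f = "\<lambda>x. ennreal (x\<^sup>2 * of_bool (\<bar>x\<bar> > u))"])
         (use prob j in \<open>auto simp: of_bool_def\<close>)
    also have "\<dots> \<le> ennreal (K * exp (- ((u / \<tau>) powr \<alpha>) / 2))"
      unfolding K_def using prob[OF j] sets_P[OF j] tail[OF j] assms(1,2) u by (rule truncated_second_moment_le)
    finally show ?thesis
      using e by (meson ennreal_leI order.trans)
  qed

  have 3: "real d * (\<Sum>j\<in>{m<..d}. (\<eta> j)\<^sup>2 * D) \<le> K * V"
  proof (cases "m < d")
    case True
    have "(\<Sum>j\<in>{m<..d}. (\<eta> j)\<^sup>2 * D) \<le> real (card {m<..d}) * (\<beta>\<^sup>2 * D)"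
      using sq D by (intro sum_bounded_above mult_right_mono) auto
    \<comment> \<open>A second factor \<open>d\<close>, from the number of coordinates, joins the
      one from the Cauchy-Schwarz inequality.\<close>
    also have "\<dots> \<le> real d * (\<beta>\<^sup>2 * D)"
      using D by (intro mult_right_mono) auto
    finally have "real d * (\<Sum>j\<in>{m<..d}. (\<eta> j)\<^sup>2 * D) \<le> real d * (real d * (\<beta>\<^sup>2 * D))"
      by (intro mult_left_mono) auto
    also have "\<dots> = K * ((real s)\<^sup>2 * \<beta>\<^sup>2)"
      using assms(5,6) by (simp add: D_def power2_eq_square field_simps)
    also have "\<dots> \<le> K * V"
      using weight'[OF True] K by (rule mult_left_mono)
    finally show ?thesis .
  qed (use V K in simp)

  \<comment> \<open>Integrating the pointwise bound\<close>
  have meas: "(\<lambda>\<xi>. \<xi> j) \<in> borel_measurable (Pi\<^sub>M {1..d} P)" if "j \<in> {1..d}" for j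
    using measurable_component_singleton[OF that, of P] sets_P[OF that] measurable_cong_sets by blast
  have meas_trunc: "(\<lambda>\<xi>. (\<xi> j)\<^sup>2 * of_bool (\<bar>\<xi> j\<bar> > u) :: real) \<in> borel_measurable (Pi\<^sub>M {1..d} P)"
    if "j \<in> {1..d}" for j
    using meas[OF that] by measurable
  define F where "F \<xi> = (\<Sum>j\<in>{1..m} \<union> S. \<eta> j * \<xi> j)\<^sup>2" for \<xi>
  define G where "G \<xi> = (\<Sum>j\<in>{m<..d}. (\<eta> j)\<^sup>2 * ((\<xi> j)\<^sup>2 * of_bool (\<bar>\<xi> j\<bar> > u)))" for \<xi>
  have [measurable]: "F \<in> borel_measurable (Pi\<^sub>M {1..d} P)"
    unfolding F_def[abs_def] using sub
    by (intro borel_measurable_power borel_measurable_sum borel_measurable_times meas) auto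
  have [measurable]: "G \<in> borel_measurable (Pi\<^sub>M {1..d} P)"
    unfolding G_def[abs_def]
    by (intro borel_measurable_sum borel_measurable_times[OF borel_measurable_const] meas_trunc) auto
  \<comment> \<open>Independence and centring enter through this identity. The bound for
    \<open>G\<close> sums functions of single coordinates and works with the marginal laws.\<close>
  have F: "(\<integral>\<^sup>+\<xi>. ennreal (F \<xi>) \<partial>Pi\<^sub>M {1..d} P) = ennreal (\<Sum>j\<in>{1..m} \<union> S. (\<eta> j)\<^sup>2)"
    unfolding F_def by (rule nn_integral_square_sum_PiM) (use sub prob mean var in auto)
  have G: "(\<integral>\<^sup>+\<xi>. ennreal (G \<xi>) \<partial>Pi\<^sub>M {1..d} P) \<le> ennreal (\<Sum>j\<in>{m<..d}. (\<eta> j)\<^sup>2 * D)"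
  proof -
    have "(\<integral>\<^sup>+\<xi>. ennreal (G \<xi>) \<partial>Pi\<^sub>M {1..d} P)
      = (\<integral>\<^sup>+\<xi>. (\<Sum>j\<in>{m<..d}. ennreal ((\<eta> j)\<^sup>2) * ennreal ((\<xi> j)\<^sup>2 * of_bool (\<bar>\<xi> j\<bar> > u))) \<partial>Pi\<^sub>M {1..d} P)"
      unfolding G_def by (intro nn_integral_cong) (simp add: sum_ennreal[symmetric] ennreal_mult)
    also have "\<dots> = (\<Sum>j\<in>{m<..d}. \<integral>\<^sup>+\<xi>. ennreal ((\<eta> j)\<^sup>2) * ennreal ((\<xi> j)\<^sup>2 * of_bool (\<bar>\<xi> j\<bar> > u)) \<partial>Pi\<^sub>M {1..d} P)"
      by (rule nn_integral_sum) (use meas_trunc in auto)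
    also have "\<dots> = (\<Sum>j\<in>{m<..d}. ennreal ((\<eta> j)\<^sup>2) * (\<integral>\<^sup>+\<xi>. ennreal ((\<xi> j)\<^sup>2 * of_bool (\<bar>\<xi> j\<bar> > u)) \<partial>Pi\<^sub>M {1..d} P))"
      by (intro sum.cong refl nn_integral_cmult) (use meas_trunc in auto)
    also have "\<dots> \<le> (\<Sum>j\<in>{m<..d}. ennreal ((\<eta> j)\<^sup>2) * ennreal D)"
      by (intro sum_mono mult_left_mono trunc) auto
    also have "\<dots> = ennreal (\<Sum>j\<in>{m<..d}. (\<eta> j)\<^sup>2 * D)"
      using D by (simp add: sum_ennreal[symmetric] ennreal_mult)
    finally show ?thesis .
  qed
  have FG: "F \<xi> \<ge> 0" "G \<xi> \<ge> 0" for \<xi>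
    by (auto simp: F_def G_def intro!: sum_nonneg)
  define B where "B = u\<^sup>2 * (\<Sum>j\<in>S. \<bar>\<eta> j\<bar>)\<^sup>2"
  have B: "B \<ge> 0" by (simp add: B_def)
  have "mean_squared_error \<sigma> \<theta> (Pi\<^sub>M {1..d} P) (L_hat c \<alpha> d \<eta> \<sigma> s) (linear_functional d \<eta> \<theta>)
    \<le> (\<integral>\<^sup>+\<xi>. ennreal (3 * \<sigma>\<^sup>2) * ennreal (F \<xi>) + ennreal (3 * \<sigma>\<^sup>2 * B)
         + ennreal (3 * \<sigma>\<^sup>2 * real d) * ennreal (G \<xi>) \<partial>Pi\<^sub>M {1..d} P)"
    unfolding mean_squared_error_def
  proof (rule nn_integral_mono)
    fix \<xi>
    have "(L_hat c \<alpha> d \<eta> \<sigma> s (observation \<sigma> \<theta> \<xi>) - linear_functional d \<eta> \<theta>)\<^sup>2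
      \<le> 3 * \<sigma>\<^sup>2 * F \<xi> + 3 * \<sigma>\<^sup>2 * B + 3 * \<sigma>\<^sup>2 * real d * G \<xi>"
      using L_hat_error_le[OF assms(3) less_imp_le[OF c], where \<theta> = \<theta> and \<xi> = \<xi> and \<alpha> = \<alpha> and d = d and s = s and \<eta> = \<eta>]
      by (simp add: F_def G_def B_def u_def l_def m_def S_def mult.assoc)
    thus "ennreal ((L_hat c \<alpha> d \<eta> \<sigma> s (observation \<sigma> \<theta> \<xi>) - linear_functional d \<eta> \<theta>)\<^sup>2)
      \<le> ennreal (3 * \<sigma>\<^sup>2) * ennreal (F \<xi>) + ennreal (3 * \<sigma>\<^sup>2 * B) + ennreal (3 * \<sigma>\<^sup>2 * real d) * ennreal (G \<xi>)"
      using FG B by (simp add: ennreal_mult[symmetric] ennreal_plus[symmetric] ennreal_leI del: ennreal_plus)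
  qed
  \<comment> \<open>All terms are nonnegative, so integration in [0,\<infinity>] is additive without
    prior integrability; \<open>B\<close> is constant and the total mass is 1.\<close>
  also have "\<dots> = ennreal (3 * \<sigma>\<^sup>2) * (\<integral>\<^sup>+\<xi>. ennreal (F \<xi>) \<partial>Pi\<^sub>M {1..d} P) + ennreal (3 * \<sigma>\<^sup>2 * B)
         + ennreal (3 * \<sigma>\<^sup>2 * real d) * (\<integral>\<^sup>+\<xi>. ennreal (G \<xi>) \<partial>Pi\<^sub>M {1..d} P)"
    by (simp add: nn_integral_add nn_integral_cmult PP.emeasure_space_1 del: One_nat_def)
  also have "\<dots> \<le> ennreal (3 * \<sigma>\<^sup>2) * ennreal (2 * V) + ennreal (3 * \<sigma>\<^sup>2 * (c\<^sup>2 * V))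
         + ennreal (3 * \<sigma>\<^sup>2 * real d) * ennreal (\<Sum>j\<in>{m<..d}. (\<eta> j)\<^sup>2 * D)"
    unfolding F using 1 2 by (intro add_mono mult_left_mono G ennreal_leI) (auto simp: B_def)
  also have "\<dots> = ennreal (3 * \<sigma>\<^sup>2 * (2 * V) + 3 * \<sigma>\<^sup>2 * (c\<^sup>2 * V) + 3 * \<sigma>\<^sup>2 * (real d * (\<Sum>j\<in>{m<..d}. (\<eta> j)\<^sup>2 * D)))"
    using V D by (simp add: ennreal_mult[symmetric] ennreal_plus[symmetric] sum_nonneg mult.assoc del: ennreal_plus)
  also have "\<dots> \<le> ennreal (3 * \<sigma>\<^sup>2 * (2 * V) + 3 * \<sigma>\<^sup>2 * (c\<^sup>2 * V) + 3 * \<sigma>\<^sup>2 * (K * V))"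
    using 3 by (intro ennreal_leI add_left_mono mult_left_mono) auto
  also have "\<dots> = ennreal (3 * (2 + c\<^sup>2 + K) * \<sigma>\<^sup>2 * V)"
    by (simp add: algebra_simps)
  finally show ?thesis by (simp add: V_def m_def)
qed

theorem theorem6:
  fixes \<alpha> \<tau> :: real
  assumes "\<alpha> > 0" and "\<tau> > 0"
  shows "\<exists>c>0. \<exists>C>0. \<forall>(d::nat) (\<eta>::nat \<Rightarrow> real) (\<sigma>::real) (s::nat).
    d \<ge> 1 \<longrightarrow> ordered_weights d \<eta> \<longrightarrow> \<sigma> > 0 \<longrightarrow> 1 \<le> s \<longrightarrow> s \<le> d \<longrightarrow>
    (SUP \<theta>\<in>sparse_vectors d s. SUP P\<xi>\<in>product_noise_class d \<alpha> \<tau>.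
       mean_squared_error \<sigma> \<theta> P\<xi> (L_hat c \<alpha> d \<eta> \<sigma> s) (linear_functional d \<eta> \<theta>))
    \<le> ennreal (C * \<sigma>\<^sup>2 * (\<Sum>j\<in>{1..j3 \<alpha> d s}. (\<eta> j)\<^sup>2))"
proof -
  \<comment> \<open>Both constants are fixed before \<open>d\<close>, \<eta>, \<sigma> and
    \<open>s\<close>, so they depend on \<alpha> and \<tau> only.\<close>
  define c where "c = \<tau> * 4 powr (1 / \<alpha>)"
  define K where "K = 2 * (\<Sum>k. (real k + 1)\<^sup>2 * exp (- ((real k / \<tau>) powr \<alpha>) / 2))"
  have "K \<ge> 0"
    unfolding K_def using summable_stretched_exp[OF assms] by (auto intro!: suminf_nonneg)
  hence "3 * (2 + c\<^sup>2 + K) > 0"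
    by (smt (verit) zero_le_power2)
  moreover have "c > 0"
    using assms by (simp add: c_def)
  moreover have "(SUP \<theta>\<in>sparse_vectors d s. SUP P\<xi>\<in>product_noise_class d \<alpha> \<tau>.
       mean_squared_error \<sigma> \<theta> P\<xi> (L_hat c \<alpha> d \<eta> \<sigma> s) (linear_functional d \<eta> \<theta>))
    \<le> ennreal (3 * (2 + c\<^sup>2 + K) * \<sigma>\<^sup>2 * (\<Sum>j\<in>{1..j3 \<alpha> d s}. (\<eta> j)\<^sup>2))"
    if "ordered_weights d \<eta>" "\<sigma> > 0" "1 \<le> s" "s \<le> d" for d \<eta> \<sigma> s
  \<comment> \<open>The bound involves neither \<theta> nor the noise law, so it passes to both
    suprema.\<close>
  proof (intro SUP_least)
    fix \<theta> P\<xi>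
    assume \<theta>: "\<theta> \<in> sparse_vectors d s" and "P\<xi> \<in> product_noise_class d \<alpha> \<tau>"
    then obtain P where P: "P\<xi> = Pi\<^sub>M {1..d} P" "\<And>j. j \<in> {1..d} \<Longrightarrow> P j \<in> noise_class \<alpha> \<tau>"
      unfolding product_noise_class_def by blast
    show "mean_squared_error \<sigma> \<theta> P\<xi> (L_hat c \<alpha> d \<eta> \<sigma> s) (linear_functional d \<eta> \<theta>)
      \<le> ennreal (3 * (2 + c\<^sup>2 + K) * \<sigma>\<^sup>2 * (\<Sum>j\<in>{1..j3 \<alpha> d s}. (\<eta> j)\<^sup>2))"
      unfolding P(1) c_def K_def
      by (rule mean_squared_error_L_hat_le) (fact assms that \<theta> P(2))+
  qed
  ultimately show ?thesis
    by blast
qed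

end
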